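(* Let $\mathcal A$ be an indexing collection of finite dimension on $\mathcal T$ with compatible metric $d_{\mathcal A}$ and reference measure $m$ as in the context. Let $A\in\mathcal A$, let $h:\mathcal A\to\mathbb R$ (with $h(\varnothing)=0$) be an OJI function in generic configuration in the victiny of $A$, and let $(s_n)_{n\in\mathbb N}$ be a sequence in $\Pi(h)$ such that $\mathfrak d(s_n,A)\to0$ as $n\to\infty$. Then $$\alpha_h(A)\ \le\ \max\left\{\liminf_{n\to\infty}\frac{\log|J_{s_n}(h)|}{\log\mathfrak d(s_n,A)},\ 0\right\}.$$
   Context: Indexing collection. $\mathcal T$ is a non-empty set. $\mathcal A\subseteq\mathcal P(\mathcal T)$ is an indexing collection on $\mathcal T$ if: (1) $\varnothing\in\mathcal A$, and $\mathcal A$ and $\mathcal A\setminus\{\varnothing\}$ are closed under countable intersections; (2) there is an increasing sequence of finite subcollections $\mathcal A_n\subseteq\mathcal A$ ($n\in\mathbb N$), each closed under intersections, such that with $g_n(A)=\bigcap\{A'\in\mathcal A_n\cup\{\mathcal T\}:A\subseteq A'\}$ one has $A=\bigcap_n g_n(A)$ for all $A\in\mathcal A$; (3) (SHAPE) if $A,A_1,\dots,A_n\in\mathcal A$ and $A\subseteq\bigcup_{i\le n}A_i$ then $A\subseteq A_j$ for some $j$; (4) (TIP) the map $t\mapsto A(t)=\bigcap_nA_n(t)$, with $A_n(t)=\bigcap\{A\in\mathcal A_n\cup\{\mathcal T\}:t\in A\}$, is a bijection from $\mathcal T$ onto $\mathcal A\setminus\{\varnothing\}$. The sequence $(\mathcal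 A_n)$ is fixed, and $\varnothing$ and $\varnothing'=\bigcap_{A\in\mathcal A,A\ne\varnothing}A$ are assumed to belong to every $\mathcal A_n$. Classes. $\mathcal D(u)$ is the class of finite unions of elements of $\mathcal D$; $\mathcal C=\{A\setminus U:A\in\mathcal A,U\in\mathcal A(u)\}$; $\mathcal C_k=\{A_0\setminus\bigcup_{i=1}^{k+1}A_i:A_i\in\mathcal A\}$. $\mathcal C^\ell(\mathcal A_n)$ is the (pairwise disjoint) collection of sets $A\setminus\bigcup_{A'\in\mathcal A_n,A'\subsetneq A}A'$, $A\in\mathcal A_n$; $\mathcal C^\ell=\bigcup_n\mathcal C^\ell(\mathcal A_n)$; $C_n(t)$ is the element of $\mathcal C^\ell(\mathcal A_n)$ containing $t$ if there is one, and $\mathcal T$ otherwise. For $h:\mathcal A\to\mathbb R$ with $h(\varnothing)=0$, $\Delta h:\mathcal C(u)\to\mathbb R$ is its unique additive extension. Finite dimension: there is $p\in\mathbb N^*$ such that every $(\mathcal A_n,\subseteq)$ admits an order embedding into $\mathbb N^p$ (componentwise order) and $\mathcal C^\ell\subseteq\mathcal C_{p-1}$. Compatible metric. A pseudo-metric $d_{\mathcal A}$ on $\mathcal A$ ("metric" for short), transported to $\mathcal T$ by $d_{\mathcal T}(s,t)=d_{\mathcal A}(A(s),A(t))$, is compatible if: (i) $d_{\mathcal A}(A\cap A'',A'\cap A'')\le d_{\mathcal A}(A,A')$; (ii) $d_{\mathcal A}(A_n,\bigcap_kA_k)\to0$ for every non-increasing sequence $(A_n)$ in $\mathcal A$; (iii)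 $\max_{C\in\mathcal C^\ell(\mathcal A_n)}\sup_{s,s'\in C}d_{\mathcal T}(s,s')\to0$; (iv) for $A\subseteq A'$ in $\mathcal A$ there is $A''\in\mathcal A$ with $A\subseteq A''\subseteq A'$ and $d_{\mathcal A}(A,A'')=d_{\mathcal A}(A'',A')=d_{\mathcal A}(A,A')/2$. A compatible $d_{\mathcal A}$ is fixed, with open balls $B_{\mathcal A}(A,\rho)$. $m$ is a measure on $(\mathcal T,\sigma(\mathcal A))$, finite on $\mathcal A$, such that $d_m(A,A')=m(A\triangle A')$ is also compatible. Victiny and divergence. $\mathcal V(A,\rho)=\bigcup_{A'\in B_{\mathcal A}(A,\rho)}(A\triangle A')$, $\mathfrak d(t,A)=\inf\{\rho>0:t\in\mathcal V(A,\rho)\}$. We use $\log0=-\infty$, so that the quotient is $0$ when $\mathfrak d(s_n,A)=0$. Jumps. $J_t(h)=\lim_{n\to\infty}\Delta h(C_n(t))$ when the limit exists. $h$ has well-defined jumps if $J_t(h)$ exists for all $t\in\mathcal T$ and $\{t\in A:|J_t(h)|>\varepsilon\}$ is finite for all $A\in\mathcal A$, $\varepsilon>0$. $\Pi(h)=\{t\in\mathcal T:J_t(h)\ne0\}$. OJI function. $h$ with well-defined jumps is only jump-irregular (OJI) if there is a continuous $a:\mathcal A\times(0,1)\to\mathbb R$ ($\mathcal A$ endowed with $d_m$) such that $h(A)=\lim_{\varepsilon\to0^+}\big[\sum_{s\in\Pi(h)\cap A,\,|J_s(h)|\ge\varepsilon}J_s(h)-a(A,\varepsilon)\big]$ for all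 $A\in\mathcal A$, the limit being uniform on $\{A'\in\mathcal A:A'\subseteq A\}$ for each $A\in\mathcal A$. Generic configuration. An OJI function $h$ is in generic configuration in the victiny of $A$ if there is $\rho_0>0$ such that for all $\rho\in(0,\rho_0)$, $s\in\Pi(h)\cap\mathcal V(A,\rho)$ and $\varepsilon>0$, there exist $\underline A,\overline A\in B_{\mathcal A}(A,\rho)$ with $\underline A\subseteq\overline A$ and $|\Delta h(\overline A\setminus\underline A)-J_s(h)|\le\varepsilon$. Hölder exponent: $\alpha_h(A)=\sup\{\alpha\ge0:\limsup_{\rho\to0^+}\sup_{A'\in B_{\mathcal A}(A,\rho)}|h(A)-h(A')|\rho^{-\alpha}<\infty\}$ ($\sup\varnothing=0$). *)

theory Defs
  imports "HOL-Analysis.Analysis"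
begin

text \<open>
  Throughout, \<open>T\<close> is the carrier set, \<open>\<A>\<close> the indexing collection and \<open>\<A>n\<close> the fixed sequence of
  finite subcollections. Functions on \<open>\<A>\<close> are total functions on \<open>'a set\<close>, of which only
  the values on \<open>\<A>\<close> are ever used.
\<close>

definition approx_set :: "'a set \<Rightarrow> (nat \<Rightarrow> 'a set set) \<Rightarrow> nat \<Rightarrow> 'a set \<Rightarrow> 'a set" where
  "approx_set T \<A>n n A = \<Inter>{A' \<in> \<A>n n \<union> {T}. A \<subseteq> A'}"

definition point_set_at :: "'a set \<Rightarrow> (nat \<Rightarrow> 'a set set) \<Rightarrow> nat \<Rightarrow> 'a \<Rightarrow> 'a set" where
  "point_set_at T \<A>n n t = \<Inter>{A \<in> \<A>n n \<union> {T}. t \<in> A}"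

definition point_set :: "'a set \<Rightarrow> (nat \<Rightarrow> 'a set set) \<Rightarrow> 'a \<Rightarrow> 'a set" where
  "point_set T \<A>n t = (\<Inter>n. point_set_at T \<A>n n t)"

text \<open>
  Intersections, and the union in the fifth clause below (SHAPE), are over non-empty families:
  \<open>T\<close> need not belong to \<open>\<A>\<close>, and SHAPE would fail for \<open>A = {}\<close> with an empty family.
  The sixth clause is TIP; the last one is the convention that \<open>{}\<close> and
  \<open>\<Inter>(\<A> - {{}})\<close> belong to every \<open>\<A>n n\<close>.
\<close>

definition indexing_collection :: "'a set \<Rightarrow> 'a set set \<Rightarrow> (nat \<Rightarrow> 'a set set) \<Rightarrow> bool" where
  "indexing_collection T \<A> \<A>n \<longleftrightarrow>
     (T \<noteq> {} \<and> \<A> \<subseteq> Pow T) \<and>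
     ({} \<in> \<A> \<and>
       (\<forall>F. countable F \<and> F \<noteq> {} \<and> F \<subseteq> \<A> \<longrightarrow> \<Inter>F \<in> \<A>) \<and>
       (\<forall>F. countable F \<and> F \<noteq> {} \<and> F \<subseteq> \<A> - {{}} \<longrightarrow> \<Inter>F \<in> \<A> - {{}})) \<and>
     (incseq \<A>n \<and>
       (\<forall>n. finite (\<A>n n) \<and> \<A>n n \<subseteq> \<A> \<and> (\<forall>F. F \<noteq> {} \<and> F \<subseteq> \<A>n n \<longrightarrow> \<Inter>F \<in> \<A>n n))) \<and>
     (\<forall>A\<in>\<A>. A = (\<Inter>n. approx_set T \<A>n n A)) \<and>
     (\<forall>A\<in>\<A>. \<forall>F. finite F \<and> F \<noteq> {} \<and> F \<subseteq> \<A> \<and> A \<subseteq> \<Union>F \<longrightarrow> (\<exists>A'\<in>F. A \<subseteq> A')) \<and>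
     bij_betw (point_set T \<A>n) T (\<A> - {{}}) \<and>
     (\<forall>n. {} \<in> \<A>n n \<and> \<Inter>(\<A> - {{}}) \<in> \<A>n n)"

definition finite_unions :: "'a set set \<Rightarrow> 'a set set" where
  "finite_unions \<D> = {\<Union>F | F. finite F \<and> F \<subseteq> \<D>}"

definition class_C :: "'a set set \<Rightarrow> 'a set set" where
  "class_C \<A> = {A - U | A U. A \<in> \<A> \<and> U \<in> finite_unions \<A>}"

definition class_Ck :: "'a set set \<Rightarrow> nat \<Rightarrow> 'a set set" where
  "class_Ck \<A> k = {A 0 - (\<Union>i\<in>{1..k+1}. A i) | A :: nat \<Rightarrow> 'a set. \<forall>i\<le>k+1. A i \<in> \<A>}"

definition left_nbhds :: "(nat \<Rightarrow> 'a set set) \<Rightarrow> nat \<Rightarrow> 'a set set" where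
  "left_nbhds \<A>n n = {A - \<Union>{A' \<in> \<A>n n. A' \<subset> A} | A. A \<in> \<A>n n}"

definition left_nbhd_at :: "'a set \<Rightarrow> (nat \<Rightarrow> 'a set set) \<Rightarrow> nat \<Rightarrow> 'a \<Rightarrow> 'a set" where
  "left_nbhd_at T \<A>n n t =
     (if \<exists>C\<in>left_nbhds \<A>n n. t \<in> C then (THE C. C \<in> left_nbhds \<A>n n \<and> t \<in> C) else T)"

text \<open>An element of \<open>\<nat>\<^sup>p\<close> is a function \<open>nat \<Rightarrow> nat\<close> of which only the components below \<open>p\<close> matter.\<close>

definition finite_dimension :: "'a set set \<Rightarrow> (nat \<Rightarrow> 'a set set) \<Rightarrow> bool" where
  "finite_dimension \<A> \<A>n \<longleftrightarrow>
     (\<exists>p\<ge>1.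
        (\<forall>n. \<exists>\<phi> :: 'a set \<Rightarrow> nat \<Rightarrow> nat.
           \<forall>A\<in>\<A>n n. \<forall>A'\<in>\<A>n n. A \<subseteq> A' \<longleftrightarrow> (\<forall>i<p. \<phi> A i \<le> \<phi> A' i)) \<and>
        (\<Union>n. left_nbhds \<A>n n) \<subseteq> class_Ck \<A> (p - 1))"

definition pseudo_metric_on :: "'b set \<Rightarrow> ('b \<Rightarrow> 'b \<Rightarrow> real) \<Rightarrow> bool" where
  "pseudo_metric_on X d \<longleftrightarrow>
     (\<forall>x\<in>X. \<forall>y\<in>X. 0 \<le> d x y \<and> d x y = d y x) \<and> (\<forall>x\<in>X. d x x = 0) \<and>
     (\<forall>x\<in>X. \<forall>y\<in>X. \<forall>z\<in>X. d x z \<le> d x y + d y z)"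

definition pm_ball :: "'b set \<Rightarrow> ('b \<Rightarrow> 'b \<Rightarrow> real) \<Rightarrow> 'b \<Rightarrow> real \<Rightarrow> 'b set" where
  "pm_ball X d x \<rho> = {y \<in> X. d x y < \<rho>}"

definition pm_topology :: "'b set \<Rightarrow> ('b \<Rightarrow> 'b \<Rightarrow> real) \<Rightarrow> 'b topology" where
  "pm_topology X d = topology_generated_by {pm_ball X d x \<rho> | x \<rho>. x \<in> X \<and> 0 < \<rho>}"

definition point_dist ::
  "'a set \<Rightarrow> (nat \<Rightarrow> 'a set set) \<Rightarrow> ('a set \<Rightarrow> 'a set \<Rightarrow> real) \<Rightarrow> 'a \<Rightarrow> 'a \<Rightarrow> real" where
  "point_dist T \<A>n d s t = d (point_set T \<A>n s) (point_set T \<A>n t)"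

text \<open>
  In the third condition below the suprema may be infinite for some \<open>n\<close> and the collection
  \<open>left_nbhds \<A>n n\<close> contains the empty set, hence the suprema (including the maximum over
  this finite collection) are taken in \<open>ennreal\<close>, where \<open>Sup {} = 0\<close>.
\<close>

definition compatible_metric ::
  "'a set \<Rightarrow> 'a set set \<Rightarrow> (nat \<Rightarrow> 'a set set) \<Rightarrow> ('a set \<Rightarrow> 'a set \<Rightarrow> real) \<Rightarrow> bool" where
  "compatible_metric T \<A> \<A>n d \<longleftrightarrow>
     pseudo_metric_on \<A> d \<and>
     (\<forall>A\<in>\<A>. \<forall>A'\<in>\<A>. \<forall>A''\<in>\<A>. d (A \<inter> A'') (A' \<inter> A'') \<le> d A A') \<and>
     (\<forall>B. decseq B \<and> range B \<subseteq> \<A> \<longrightarrow> (\<lambda>n. d (B n) (\<Inter>k. B k)) \<longlonglongrightarrow> 0) \<and>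
     (\<lambda>n. SUP C\<in>left_nbhds \<A>n n. SUP s\<in>C. SUP s'\<in>C. ennreal (point_dist T \<A>n d s s'))
       \<longlonglongrightarrow> 0 \<and>
     (\<forall>A\<in>\<A>. \<forall>A'\<in>\<A>. A \<subseteq> A' \<longrightarrow>
        (\<exists>A''\<in>\<A>. A \<subseteq> A'' \<and> A'' \<subseteq> A' \<and> d A A'' = d A A' / 2 \<and> d A'' A' = d A A' / 2))"

definition measure_dist :: "'a measure \<Rightarrow> 'a set \<Rightarrow> 'a set \<Rightarrow> real" where
  "measure_dist m A A' = measure m (sym_diff A A')"

definition reference_measure ::
  "'a set \<Rightarrow> 'a set set \<Rightarrow> (nat \<Rightarrow> 'a set set) \<Rightarrow> 'a measure \<Rightarrow> bool" where
  "reference_measure T \<A> \<A>n m \<longleftrightarrow>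
     space m = T \<and> sets m = sigma_sets T \<A> \<and> (\<forall>A\<in>\<A>. emeasure m A < \<infinity>) \<and>
     compatible_metric T \<A> \<A>n (measure_dist m)"

definition victiny ::
  "'a set set \<Rightarrow> ('a set \<Rightarrow> 'a set \<Rightarrow> real) \<Rightarrow> 'a set \<Rightarrow> real \<Rightarrow> 'a set" where
  "victiny \<A> d A \<rho> = (\<Union>A'\<in>pm_ball \<A> d A \<rho>. sym_diff A A')"

text \<open>
  A real infimum suffices: for \<open>A \<in> \<A>\<close> and \<open>t \<in> T\<close> the set below is non-empty, as \<open>t\<close> lies in
  the symmetric difference of \<open>A\<close> with \<open>{}\<close> or with \<open>point_set T \<A>n t\<close>.
\<close>

definition divergence ::
  "'a set set \<Rightarrow> ('a set \<Rightarrow> 'a set \<Rightarrow> real) \<Rightarrow> 'a \<Rightarrow> 'a set \<Rightarrow> real" where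
  "divergence \<A> d t A = Inf {\<rho>. 0 < \<rho> \<and> t \<in> victiny \<A> d A \<rho>}"

text \<open>
  The unique additive extension of \<open>h\<close> (with \<open>h {} = 0\<close>) to \<open>finite_unions (class_C \<A>)\<close>, which
  contains \<open>\<A>\<close>; requiring it to be \<open>extensional\<close> pins down the irrelevant values.
\<close>

definition increment :: "'a set set \<Rightarrow> ('a set \<Rightarrow> real) \<Rightarrow> 'a set \<Rightarrow> real" where
  "increment \<A> h =
     (THE f. f \<in> extensional (finite_unions (class_C \<A>)) \<and> (\<forall>A\<in>\<A>. f A = h A) \<and>
        (\<forall>C\<in>finite_unions (class_C \<A>). \<forall>D\<in>finite_unions (class_C \<A>).
           C \<inter> D = {} \<longrightarrow> f (C \<union> D) = f C + f D))"

definition jump ::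
  "'a set \<Rightarrow> 'a set set \<Rightarrow> (nat \<Rightarrow> 'a set set) \<Rightarrow> ('a set \<Rightarrow> real) \<Rightarrow> 'a \<Rightarrow> real" where
  "jump T \<A> \<A>n h t = lim (\<lambda>n. increment \<A> h (left_nbhd_at T \<A>n n t))"

definition well_defined_jumps ::
  "'a set \<Rightarrow> 'a set set \<Rightarrow> (nat \<Rightarrow> 'a set set) \<Rightarrow> ('a set \<Rightarrow> real) \<Rightarrow> bool" where
  "well_defined_jumps T \<A> \<A>n h \<longleftrightarrow>
     (\<forall>t\<in>T. convergent (\<lambda>n. increment \<A> h (left_nbhd_at T \<A>n n t))) \<and>
     (\<forall>A\<in>\<A>. \<forall>\<epsilon>>0. finite {t \<in> A. \<bar>jump T \<A> \<A>n h t\<bar> > \<epsilon>})"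

definition jump_points ::
  "'a set \<Rightarrow> 'a set set \<Rightarrow> (nat \<Rightarrow> 'a set set) \<Rightarrow> ('a set \<Rightarrow> real) \<Rightarrow> 'a set" where
  "jump_points T \<A> \<A>n h = {t \<in> T. jump T \<A> \<A>n h t \<noteq> 0}"

definition only_jump_irregular ::
  "'a set \<Rightarrow> 'a set set \<Rightarrow> (nat \<Rightarrow> 'a set set) \<Rightarrow> 'a measure \<Rightarrow> ('a set \<Rightarrow> real) \<Rightarrow> bool" where
  "only_jump_irregular T \<A> \<A>n m h \<longleftrightarrow>
     well_defined_jumps T \<A> \<A>n h \<and>
     (\<exists>a :: 'a set \<Rightarrow> real \<Rightarrow> real.
        continuous_map
          (prod_topology (pm_topology \<A> (measure_dist m)) (top_of_set {0<..<1}))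
          euclideanreal (\<lambda>(A, \<epsilon>). a A \<epsilon>) \<and>
        (\<forall>A\<in>\<A>. uniform_limit {A' \<in> \<A>. A' \<subseteq> A}
           (\<lambda>\<epsilon> A'. (\<Sum>s | s \<in> jump_points T \<A> \<A>n h \<inter> A' \<and> \<bar>jump T \<A> \<A>n h s\<bar> \<ge> \<epsilon>.
                       jump T \<A> \<A>n h s) - a A' \<epsilon>)
           h (at_right 0)))"

definition generic_configuration ::
  "'a set \<Rightarrow> 'a set set \<Rightarrow> (nat \<Rightarrow> 'a set set) \<Rightarrow> ('a set \<Rightarrow> 'a set \<Rightarrow> real)
     \<Rightarrow> ('a set \<Rightarrow> real) \<Rightarrow> 'a set \<Rightarrow> bool" where
  "generic_configuration T \<A> \<A>n d h A \<longleftrightarrow>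
     (\<exists>\<rho>\<^sub>0>0. \<forall>\<rho>. 0 < \<rho> \<and> \<rho> < \<rho>\<^sub>0 \<longrightarrow>
        (\<forall>s \<in> jump_points T \<A> \<A>n h \<inter> victiny \<A> d A \<rho>. \<forall>\<epsilon>>0.
           \<exists>A\<^sub>1\<in>pm_ball \<A> d A \<rho>. \<exists>A\<^sub>2\<in>pm_ball \<A> d A \<rho>. A\<^sub>1 \<subseteq> A\<^sub>2 \<and>
             \<bar>increment \<A> h (A\<^sub>2 - A\<^sub>1) - jump T \<A> \<A>n h s\<bar> \<le> \<epsilon>))"

text \<open>Inserting \<open>0\<close> implements \<open>Sup {} = 0\<close>, which does not hold in \<open>ereal\<close>.\<close>

definition holder_exponent ::
  "'a set set \<Rightarrow> ('a set \<Rightarrow> 'a set \<Rightarrow> real) \<Rightarrow> ('a set \<Rightarrow> real) \<Rightarrow> 'a set \<Rightarrow> ereal" where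
  "holder_exponent \<A> d h A =
     Sup (insert 0 {ereal \<alpha> | \<alpha>. \<alpha> \<ge> 0 \<and>
       Limsup (at_right 0)
         (\<lambda>\<rho>. SUP A'\<in>pm_ball \<A> d A \<rho>. ereal (\<bar>h A - h A'\<bar> * \<rho> powr (- \<alpha>))) < \<infinity>})"

text \<open>The quotient of \<open>log x\<close> by \<open>log y\<close> for \<open>x > 0\<close>, with \<open>log 0 = -\<infinity>\<close> in the denominator.\<close>

definition log_quotient :: "real \<Rightarrow> real \<Rightarrow> real" where
  "log_quotient x y = (if y = 0 then 0 else ln x / ln y)"

end

theory Submission
  imports Defs "HOL-Library.Function_Algebras"
begin

text \<open>
  If \<open>h\<close> is \<open>\<alpha>\<close>-Hoelder at \<open>A\<close>, every increment \<open>h A\<^sub>2 - h A\<^sub>1\<close> with \<open>A\<^sub>1 \<subseteq> A\<^sub>2\<close> in the \<open>\<rho>\<close>-ball around \<open>A\<close>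
  is \<open>O(\<rho> powr \<alpha>)\<close>. By generic configuration such increments approximate the jump at any jump
  point of divergence less than \<open>\<rho>\<close>; letting \<open>\<rho>\<close> decrease to the divergence \<open>\<delta>\<close> bounds the jump by
  \<open>O(\<delta> powr \<alpha>)\<close>, and taking logarithms gives \<open>\<alpha>\<close> as a lower bound for the \<open>liminf\<close>.
  The increment map is well defined because SHAPE makes the indicators of the non-empty
  indexing sets linearly independent, so that \<open>h\<close> extends to a linear functional on functions.
\<close>

section \<open>Additive extension of set functions\<close>

text \<open>Removing one more set \<open>B\<close> splits \<open>A - \<Union>F\<close> disjointly
  into \<open>A - \<Union>(insert B F)\<close> and \<open>A \<inter> B - \<Union>F\<close>. The
  induction hypothesis kills the whole and the last piece, the latter because
  \<open>A \<inter> B\<close> is again in \<open>X\<close>; hence \<open>A\<close> must be arbitrary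
  in the induction.\<close>

lemma additive_zero_Diff_Union:
  fixes e :: "'a set \<Rightarrow> real"
  assumes R: "ring_of_sets \<Omega> R" and X: "X \<subseteq> R" "\<And>A B. A \<in> X \<Longrightarrow> B \<in> X \<Longrightarrow> A \<inter> B \<in> X"
    and add: "\<And>C D. C \<in> R \<Longrightarrow> D \<in> R \<Longrightarrow> C \<inter> D = {} \<Longrightarrow> e (C \<union> D) = e C + e D"
    and zero: "\<And>A. A \<in> X \<Longrightarrow> e A = 0"
    and F: "finite F" "F \<subseteq> X" "A \<in> X"
  shows "e (A - \<Union>F) = 0"
  using F
proof (induction F arbitrary: A)
  case empty
  then show ?case by (simp add: zero)
next
  case (insert B F)
  interpret ring_of_sets \<Omega> R by (rule R)
  have U: "\<Union>F \<in> R" using insert X by (intro finite_Union) auto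
  have in_R: "A \<in> R" "B \<in> R" using insert X by auto
  have "A - \<Union>F = (A - \<Union>(insert B F)) \<union> (A \<inter> B - \<Union>F)" by auto
  then have "e (A - \<Union>F) = e ((A - \<Union>(insert B F)) \<union> (A \<inter> B - \<Union>F))" by simp
  also have "\<dots> = e (A - \<Union>(insert B F)) + e (A \<inter> B - \<Union>F)"
    using in_R U by (intro add) auto
  finally show ?case using insert X by auto
qed

text \<open>The union is made disjoint one set at a time: each new \<open>B\<close> contributes only
  \<open>B - \<Union>F\<close>, which the previous lemma handles.\<close>

lemma additive_zero_Union:
  fixes e :: "'a set \<Rightarrow> real"
  assumes R: "ring_of_sets \<Omega> R" and X: "X \<subseteq> R" "\<And>A B. A \<in> X \<Longrightarrow> B \<in> X \<Longrightarrow> A \<inter> B \<in> X"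
    and add: "\<And>C D. C \<in> R \<Longrightarrow> D \<in> R \<Longrightarrow> C \<inter> D = {} \<Longrightarrow> e (C \<union> D) = e C + e D"
    and zero: "\<And>A. A \<in> X \<Longrightarrow> e A = 0"
    and F: "finite F" "F \<subseteq> X"
  shows "e (\<Union>F) = 0"
  using F
proof (induction F)
  case empty
  interpret ring_of_sets \<Omega> R by (rule R)
  \<comment> \<open>Additivity at two empty sets reads \<open>e {} = e {} + e {}\<close>.\<close>
  show ?case using add[of "{}" "{}"] by simp
next
  case (insert B F)
  interpret ring_of_sets \<Omega> R by (rule R)
  have U: "\<Union>F \<in> R" using insert X by (intro finite_Union) auto
  have "e (\<Union>(insert B F)) = e (\<Union>F \<union> (B - \<Union>F))" by (simp add: Un_commute)
  also have "\<dots> = e (\<Union>F) + e (B - \<Union>F)"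
    using insert X U by (intro add) auto
  also have "e (B - \<Union>F) = 0"
    by (rule additive_zero_Diff_Union[where e = e, OF R X])
      (use insert add zero in \<open>auto\<close>)
  finally show ?case using insert by simp
qed

section \<open>The ring of finite unions of differences\<close>

lemma finite_unionsI: "finite F \<Longrightarrow> F \<subseteq> \<D> \<Longrightarrow> \<Union>F \<in> finite_unions \<D>"
  by (auto simp: finite_unions_def)

lemma subset_finite_unions: "\<D> \<subseteq> finite_unions \<D>"
  using finite_unionsI[of "{D}" \<D> for D] by auto

lemma finite_unions_Un:
  assumes "C \<in> finite_unions \<D>" "D \<in> finite_unions \<D>"
  shows "C \<union> D \<in> finite_unions \<D>"
proof -
  obtain F G where "finite F" "F \<subseteq> \<D>" "C = \<Union>F" "finite G" "G \<subseteq> \<D>" "D = \<Union>G"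
    using assms by (auto simp: finite_unions_def)
  then show ?thesis using finite_unionsI[of "F \<union> G" \<D>] by auto
qed

lemma finite_unions_UN:
  "finite I \<Longrightarrow> (\<And>i. i \<in> I \<Longrightarrow> C i \<in> finite_unions \<D>) \<Longrightarrow> (\<Union>i\<in>I. C i) \<in> finite_unions \<D>"
  by (induction I rule: finite_induct)
    (use finite_unionsI[of "{}" \<D>] in \<open>auto intro: finite_unions_Un\<close>)

text \<open>Stability under intersection gives the ring structure and the uniqueness of the additive
  extension; SHAPE gives its existence.\<close>

locale shape_collection =
  fixes \<A> :: "'a set set"
  assumes empty_mem: "{} \<in> \<A>"
    and Int_mem: "A \<in> \<A> \<Longrightarrow> B \<in> \<A> \<Longrightarrow> A \<inter> B \<in> \<A>"
    and shape: "A \<in> \<A> \<Longrightarrow> finite F \<Longrightarrow> F \<noteq> {} \<Longrightarrow> F \<subseteq> \<A> \<Longrightarrow> A \<subseteq> \<Union>F \<Longrightarrow> \<exists>B\<in>F. A \<subseteq> B"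
begin

lemma class_CI: "A \<in> \<A> \<Longrightarrow> U \<in> finite_unions \<A> \<Longrightarrow> A - U \<in> class_C \<A>"
  by (auto simp: class_C_def)

lemma subset_class_C: "\<A> \<subseteq> class_C \<A>"
  using class_CI[of _ "{}"] finite_unionsI[of "{}" \<A>] by auto

lemma class_C_Int:
  assumes "C \<in> class_C \<A>" "D \<in> class_C \<A>"
  shows "C \<inter> D \<in> class_C \<A>"
proof -
  obtain A U B V where *: "A \<in> \<A>" "U \<in> finite_unions \<A>" "C = A - U"
    "B \<in> \<A>" "V \<in> finite_unions \<A>" "D = B - V"
    using assms by (auto simp: class_C_def)
  then have "C \<inter> D = A \<inter> B - (U \<union> V)" by auto
  then show ?thesis using * by (auto intro: class_CI Int_mem finite_unions_Un)
qed

text \<open>A point of \<open>A - U\<close> avoids \<open>B - \<Union>F\<close> either by lying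
  outside \<open>B\<close> or by lying in some \<open>G \<in> F\<close>. Each alternative is a set
  of \<open>\<A>\<close> minus a finite union.\<close>

lemma class_C_Diff:
  assumes "C \<in> class_C \<A>" "D \<in> class_C \<A>"
  shows "C - D \<in> finite_unions (class_C \<A>)"
proof -
  obtain A U B F where *: "A \<in> \<A>" "U \<in> finite_unions \<A>" "C = A - U"
    "B \<in> \<A>" "finite F" "F \<subseteq> \<A>" "D = B - \<Union>F"
    using assms(1) assms(2)[unfolded class_C_def finite_unions_def] unfolding class_C_def
    by blast
  have "B \<in> finite_unions \<A>" using * subset_finite_unions by auto
  then have 1: "A - (U \<union> B) \<in> finite_unions (class_C \<A>)"
    using * \<open>B \<in> finite_unions \<A>\<close>
    by (intro subsetD[OF subset_finite_unions class_CI] finite_unions_Un)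
  have 2: "(\<Union>G\<in>F. A \<inter> G - U) \<in> finite_unions (class_C \<A>)"
    using * by (intro finite_unions_UN subsetD[OF subset_finite_unions class_CI] Int_mem) auto
  have "C - D = (A - (U \<union> B)) \<union> (\<Union>G\<in>F. A \<inter> G - U)" using * by auto
  then show ?thesis using finite_unions_Un[OF 1 2] by simp
qed

lemma class_C_Diff_Union:
  assumes "finite F" "F \<subseteq> class_C \<A>" "C \<in> class_C \<A>"
  shows "C - \<Union>F \<in> finite_unions (class_C \<A>)"
  using assms
proof (induction F)
  case empty
  then show ?case using subset_finite_unions by auto
next
  case (insert D F)
  then obtain G where G: "finite G" "G \<subseteq> class_C \<A>" "C - \<Union>F = \<Union>G"
    by (auto simp: finite_unions_def)
  have "C - \<Union>(insert D F) = (\<Union>E\<in>G. E - D)" using G by auto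
  also have "\<dots> \<in> finite_unions (class_C \<A>)"
    using G insert by (intro finite_unions_UN class_C_Diff) auto
  finally show ?case .
qed

lemma ring_of_sets_class_C: "ring_of_sets UNIV (finite_unions (class_C \<A>))"
  unfolding ring_of_sets_iff
proof (intro conjI ballI)
  show "{} \<in> finite_unions (class_C \<A>)" using finite_unionsI[of "{}"] by auto
next
  fix C D assume C: "C \<in> finite_unions (class_C \<A>)" and D: "D \<in> finite_unions (class_C \<A>)"
  then obtain F G where *: "finite F" "F \<subseteq> class_C \<A>" "C = \<Union>F" "finite G" "G \<subseteq> class_C \<A>" "D = \<Union>G"
    by (auto simp: finite_unions_def)
  then have "C - D = (\<Union>E\<in>F. E - \<Union>G)" by auto
  also have "\<dots> \<in> finite_unions (class_C \<A>)"
    using * by (intro finite_unions_UN class_C_Diff_Union) auto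
  finally show "C - D \<in> finite_unions (class_C \<A>)" .
qed (auto intro: finite_unions_Un)

text \<open>Applied to the difference of two additive extensions, this is uniqueness. The vanishing
  spreads from \<open>\<A>\<close> to \<open>class_C \<A>\<close> and then to finite unions; both
  classes are stable under intersection.\<close>

lemma additive_zero_class_C:
  fixes e :: "'a set \<Rightarrow> real"
  assumes add: "\<And>C D. C \<in> finite_unions (class_C \<A>) \<Longrightarrow> D \<in> finite_unions (class_C \<A>) \<Longrightarrow>
      C \<inter> D = {} \<Longrightarrow> e (C \<union> D) = e C + e D"
    and zero: "\<And>A. A \<in> \<A> \<Longrightarrow> e A = 0" and C: "C \<in> finite_unions (class_C \<A>)"
  shows "e C = 0"
proof -
  note R = ring_of_sets_class_C
  have sub: "\<A> \<subseteq> finite_unions (class_C \<A>)"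
    using subset_class_C subset_finite_unions by blast
  have zero': "e B = 0" if B: "B \<in> class_C \<A>" for B
  proof -
    obtain A F where "A \<in> \<A>" "finite F" "F \<subseteq> \<A>" "B = A - \<Union>F"
      using B unfolding class_C_def finite_unions_def by blast
    then show ?thesis
      using additive_zero_Diff_Union[where e = e and X = \<A> and F = F and A = A, OF R sub]
        Int_mem add zero by simp
  qed
  obtain F where "finite F" "F \<subseteq> class_C \<A>" "C = \<Union>F"
    using C unfolding finite_unions_def by blast
  then show ?thesis
    using additive_zero_Union[where e = e and F = F, OF R subset_finite_unions]
      class_C_Int add zero' by simp
qed

section \<open>Linear independence of indicators and existence of the extension\<close>

text \<open>A maximal set of a vanishing combination has, by SHAPE, a point outside all the others.\<close>

lemma indicator_coeffs_zero:
  fixes u :: "'a set \<Rightarrow> real"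
  assumes "finite F" "F \<subseteq> \<A> - {{}}" "\<And>x. (\<Sum>A\<in>F. u A * indicator A x) = 0" "A \<in> F"
  shows "u A = 0"
proof (rule ccontr)
  assume "u A \<noteq> 0"
  \<comment> \<open>Sets with zero coefficient are dropped first, so that the maximal set chosen
    below has a nonzero coefficient.\<close>
  define G where "G = {B \<in> F. u B \<noteq> 0}"
  have "finite G" "A \<in> G" using assms \<open>u A \<noteq> 0\<close> by (auto simp: G_def)
  then obtain M where M: "M \<in> G" "\<And>B. B \<in> G \<Longrightarrow> M \<subseteq> B \<Longrightarrow> M = B"
    using finite_has_maximal[of G] by (metis empty_iff)
  have G: "G \<subseteq> \<A>" "M \<noteq> {}" using assms M by (auto simp: G_def)
  have "\<not> M \<subseteq> \<Union>(G - {M})"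
  proof
    assume sub: "M \<subseteq> \<Union>(G - {M})"
    \<comment> \<open>SHAPE speaks of non-empty families only; here \<open>M \<noteq> {}\<close>
      provides this.\<close>
    with G have "G - {M} \<noteq> {}" by auto
    then obtain B where "B \<in> G - {M}" "M \<subseteq> B"
      using shape[of M "G - {M}"] sub \<open>finite G\<close> G M by auto
    then show False using M by blast
  qed
  then obtain x where x: "x \<in> M" "\<And>B. B \<in> G \<Longrightarrow> B \<noteq> M \<Longrightarrow> x \<notin> B" by auto
  have "0 = (\<Sum>B\<in>F. u B * indicator B x)" using assms by simp
  also have "\<dots> = (\<Sum>B\<in>{M}. u B * indicator B x)"
    using assms M x by (intro sum.mono_neutral_right) (auto simp: G_def indicator_def)
  finally show False using M x by (auto simp: G_def)
qed

text \<open>A linear functional can be prescribed freely on the independent indicators, and the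
  indicator of a disjoint union is the sum of the indicators. The empty set is left out of the
  independent family, its indicator being the zero vector; \<open>h {} = 0\<close> is the matching
  value.\<close>

lemma additive_extension_exists:
  fixes h :: "'a set \<Rightarrow> real"
  assumes h0: "h {} = 0"
  obtains f where "\<And>A. A \<in> \<A> \<Longrightarrow> f A = h A" "\<And>C D. C \<inter> D = {} \<Longrightarrow> f (C \<union> D) = f C + f D"
proof -
  \<comment> \<open>Real functions on points form a vector space under pointwise addition and this
    scalar multiplication.\<close>
  define sc :: "real \<Rightarrow> ('a \<Rightarrow> real) \<Rightarrow> 'a \<Rightarrow> real" where "sc = (\<lambda>r f x. r * f x)"
  interpret vector_space_pair sc "(*) :: real \<Rightarrow> real \<Rightarrow> real"
    by unfold_locales (auto simp: sc_def fun_eq_iff algebra_simps)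
  have inj: "inj_on indicat_real (\<A> - {{}})"
    by (rule inj_on_subset[OF _ subset_UNIV], rule injI)
      (metis indicator_eq_1_iff subsetI subset_antisym)
  define B where "B = indicat_real ` (\<A> - {{}})"
  have "vs1.independent B"
    unfolding vs1.independent_explicit_module
  proof (intro allI impI)
    fix t u v assume t: "finite t" "t \<subseteq> B" and sum0: "(\<Sum>w\<in>t. sc (u w) w) = 0" and v: "v \<in> t"
    obtain F where F: "F \<subseteq> \<A> - {{}}" "finite F" "t = indicat_real ` F"
      using t finite_subset_image[of t indicat_real "\<A> - {{}}"] unfolding B_def by auto
    have inj_F: "inj_on indicat_real F" using inj F(1) by (rule inj_on_subset)
    have sum_apply: "(\<Sum>w\<in>t. sc (u w) w) x = (\<Sum>w\<in>t. u w * w x)" for x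
      using t(1) by (induction t) (simp_all add: sc_def)
    have "(\<Sum>A\<in>F. u (indicat_real A) * indicator A x) = 0" for x
    proof -
      have "(\<Sum>A\<in>F. u (indicat_real A) * indicator A x) = (\<Sum>w\<in>t. u w * w x)"
        unfolding F(3) sum.reindex[OF inj_F] comp_def ..
      also have "\<dots> = (0 :: 'a \<Rightarrow> real) x"
        unfolding sum_apply[symmetric] sum0 ..
      finally show ?thesis by simp
    qed
    then have "u (indicat_real A) = 0" if "A \<in> F" for A
      using indicator_coeffs_zero[where u = "\<lambda>A. u (indicat_real A)", OF F(2,1) _ that] by blast
    then show "u v = 0" using F(3) v by blast
  qed
  \<comment> \<open>The functional must send the indicator of \<open>A\<close> to
    \<open>h A\<close>; \<open>A\<close> is recovered from its indicator by injectivity.\<close>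
  then obtain L where L: "Vector_Spaces.linear sc (*) L"
    "\<And>w. w \<in> B \<Longrightarrow> L w = h (the_inv_into (\<A> - {{}}) indicat_real w)"
    using linear_independent_extend[of B "\<lambda>w. h (the_inv_into (\<A> - {{}}) indicat_real w)"] by auto
  show thesis
  proof (rule that[of "\<lambda>C. L (indicat_real C)"])
    fix A assume A: "A \<in> \<A>"
    show "L (indicat_real A) = h A"
    proof (cases "A = {}")
      case True
      have zero: "indicat_real {} = 0" by (simp add: fun_eq_iff)
      show ?thesis unfolding True zero h0 by (rule linear_0[OF L(1)])
    next
      case False
      then show ?thesis using A L(2) inj by (simp add: B_def the_inv_into_f_f)
    qed
  next
    fix C D :: "'a set" assume "C \<inter> D = {}"
    then have "indicat_real (C \<union> D) = indicat_real C + indicat_real D"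
      by (auto simp: fun_eq_iff indicator_def)
    then show "L (indicat_real (C \<union> D)) = L (indicat_real C) + L (indicat_real D)"
      by (simp add: linear_add[OF L(1)])
  qed
qed

text \<open>The description in \<open>increment\<close> denotes something only once existence and
  uniqueness are known. Additivity on the split of \<open>A\<^sub>2\<close> into
  \<open>A\<^sub>2 - A\<^sub>1\<close> and \<open>A\<^sub>1\<close> then gives the value.\<close>

lemma increment_Diff:
  fixes h :: "'a set \<Rightarrow> real"
  assumes h0: "h {} = 0" and A: "A\<^sub>1 \<in> \<A>" "A\<^sub>2 \<in> \<A>" "A\<^sub>1 \<subseteq> A\<^sub>2"
  shows "increment \<A> h (A\<^sub>2 - A\<^sub>1) = h A\<^sub>2 - h A\<^sub>1"
proof -
  define R where "R = finite_unions (class_C \<A>)"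
  interpret ring_of_sets UNIV R unfolding R_def by (rule ring_of_sets_class_C)
  define P where "P f \<longleftrightarrow> f \<in> extensional R \<and> (\<forall>A\<in>\<A>. f A = h A) \<and>
    (\<forall>C\<in>R. \<forall>D\<in>R. C \<inter> D = {} \<longrightarrow> f (C \<union> D) = f C + f D)" for f
  have sub: "\<A> \<subseteq> R" unfolding R_def using subset_class_C subset_finite_unions by blast
  obtain f where f: "\<And>A. A \<in> \<A> \<Longrightarrow> f A = h A" "\<And>C D. C \<inter> D = {} \<Longrightarrow> f (C \<union> D) = f C + f D"
    using additive_extension_exists[of h] h0 by blast
  \<comment> \<open>Restriction to the ring supplies the extensionality that makes the solution
    unique as a total function.\<close>
  have Pf: "P (restrict f R)" using f sub by (auto simp: P_def)
  have uniq: "g = restrict f R" if "P g" for g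
  proof (rule extensionalityI[of _ R])
    fix C assume C: "C \<in> R"
    have "(\<lambda>C. g C - restrict f R C) C = 0"
    proof (rule additive_zero_class_C[where e = "\<lambda>C. g C - restrict f R C", folded R_def])
      fix C D assume "C \<in> R" "D \<in> R" "C \<inter> D = {}"
      then have "g (C \<union> D) = g C + g D"
        "restrict f R (C \<union> D) = restrict f R C + restrict f R D"
        using that Pf unfolding P_def by blast+
      then show "g (C \<union> D) - restrict f R (C \<union> D)
          = (g C - restrict f R C) + (g D - restrict f R D)" by linarith
    next
      fix A assume "A \<in> \<A>"
      then have "g A = h A" "restrict f R A = h A" using that Pf unfolding P_def by blast+
      then show "g A - restrict f R A = 0" by linarith
    qed (rule C)
    then show "g C = restrict f R C" by simp
  qed (use that in \<open>auto simp: P_def\<close>)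
  have "increment \<A> h = (THE f. P f)" unfolding increment_def P_def R_def by simp
  also have "\<dots> = restrict f R" using Pf uniq by (rule the_equality)
  finally have inc: "increment \<A> h = restrict f R" .
  have "A\<^sub>2 - A\<^sub>1 \<in> R" using A sub by (intro Diff) auto
  then have "increment \<A> h (A\<^sub>2 - A\<^sub>1) = f (A\<^sub>2 - A\<^sub>1)" unfolding inc by simp
  moreover have "f A\<^sub>2 = f (A\<^sub>2 - A\<^sub>1) + f A\<^sub>1"
    using f(2)[of "A\<^sub>2 - A\<^sub>1" A\<^sub>1] A by (simp add: Un_absorb2 Diff_disjoint[of A\<^sub>1] inf_commute)
  ultimately show ?thesis using f(1) A by simp
qed

end

lemma indexing_collection_shape:
  assumes "indexing_collection T \<A> \<A>n"
  shows "shape_collection \<A>"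
proof
  have countable_Int: "\<And>F. countable F \<and> F \<noteq> {} \<and> F \<subseteq> \<A> \<Longrightarrow> \<Inter>F \<in> \<A>"
    using assms by (simp add: indexing_collection_def)
  show "A \<inter> B \<in> \<A>" if "A \<in> \<A>" "B \<in> \<A>" for A B
    using countable_Int[of "{A, B}"] that by auto
  show "{} \<in> \<A>" using assms by (simp add: indexing_collection_def)
  show "\<exists>B\<in>F. A \<subseteq> B"
    if "A \<in> \<A>" "finite F" "F \<noteq> {}" "F \<subseteq> \<A>" "A \<subseteq> \<Union>F" for A F
    using assms that unfolding indexing_collection_def by blast
qed

section \<open>Jumps near a point of Hoelder regularity\<close>

lemma victinyD:
  assumes ic: "indexing_collection T \<A> \<A>n" and d: "pseudo_metric_on \<A> d"
    and A: "A \<in> \<A>" and t: "t \<in> T"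
  shows divergence_nonneg: "0 \<le> divergence \<A> d t A"
    and divergence_less_imp_victiny: "divergence \<A> d t A < \<rho> \<Longrightarrow> t \<in> victiny \<A> d A \<rho>"
proof -
  let ?S = "{\<rho>. 0 < \<rho> \<and> t \<in> victiny \<A> d A \<rho>}"
  have bij: "bij_betw (point_set T \<A>n) T (\<A> - {{}})" and "{} \<in> \<A>"
    using ic by (simp_all add: indexing_collection_def)
  have "t \<in> point_set T \<A>n t" by (auto simp: point_set_def point_set_at_def t)
  \<comment> \<open>By TIP. The witness \<open>B\<close> is \<open>{}\<close> if
    \<open>t \<in> A\<close>, and otherwise this set, which contains \<open>t\<close>.\<close>
  moreover have "point_set T \<A>n t \<in> \<A>" using bij t by (auto dest: bij_betwE)
  ultimately obtain B where B: "B \<in> \<A>" "t \<in> sym_diff A B"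
    using \<open>{} \<in> \<A>\<close> by (cases "t \<in> A") auto
  moreover have "0 \<le> d A B" using d A B by (auto simp: pseudo_metric_on_def)
  \<comment> \<open>Adding \<open>1\<close> makes the radius positive and puts \<open>B\<close>
    strictly inside the open ball.\<close>
  ultimately have "d A B + 1 \<in> ?S"
    by (auto simp: victiny_def pm_ball_def intro!: bexI[of _ B])
  then have ne: "?S \<noteq> {}" by blast
  show "0 \<le> divergence \<A> d t A"
    unfolding divergence_def by (rule cInf_greatest[OF ne]) auto
  show "t \<in> victiny \<A> d A \<rho>" if less: "divergence \<A> d t A < \<rho>"
  proof -
    \<comment> \<open>Some admissible radius lies below \<rho>, and victinies grow with the
      radius.\<close>
    obtain r where "r \<in> ?S" "r < \<rho>"
      using cInf_lessD[OF ne less[unfolded divergence_def]] by blast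
    then show ?thesis by (fastforce simp: victiny_def pm_ball_def)
  qed
qed

lemma holder_bound:
  assumes "Limsup (at_right 0)
      (\<lambda>\<rho>. SUP B\<in>pm_ball \<A> d A \<rho>. ereal (\<bar>h A - h B\<bar> * \<rho> powr (- \<alpha>))) < \<infinity>"
  obtains K \<rho>\<^sub>1 :: real where "K > 0" "\<rho>\<^sub>1 > 0"
    "\<And>\<rho> B. 0 < \<rho> \<Longrightarrow> \<rho> < \<rho>\<^sub>1 \<Longrightarrow> B \<in> pm_ball \<A> d A \<rho> \<Longrightarrow> \<bar>h A - h B\<bar> \<le> K * \<rho> powr \<alpha>"
proof -
  let ?F = "\<lambda>\<rho>. SUP B\<in>pm_ball \<A> d A \<rho>. ereal (\<bar>h A - h B\<bar> * \<rho> powr (- \<alpha>))"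
  obtain k :: nat where "Limsup (at_right 0) ?F < ereal (real k)"
    using assms by (auto simp: less_PInf_Ex_of_nat)
  then have "eventually (\<lambda>\<rho>. ?F \<rho> < ereal (real k)) (at_right 0)" by (rule Limsup_lessD)
  then obtain \<rho>\<^sub>1 where \<rho>1: "\<rho>\<^sub>1 > 0" "\<And>\<rho>. 0 < \<rho> \<Longrightarrow> \<rho> < \<rho>\<^sub>1 \<Longrightarrow> ?F \<rho> < ereal (real k)"
    by (auto simp: eventually_at_right_field)
  \<comment> \<open>The summand \<open>1\<close> makes the constant positive even for
    \<open>k = 0\<close>, so that its logarithm can be taken later.\<close>
  have "\<bar>h A - h B\<bar> \<le> (real k + 1) * \<rho> powr \<alpha>"
    if "0 < \<rho>" "\<rho> < \<rho>\<^sub>1" "B \<in> pm_ball \<A> d A \<rho>" for \<rho> B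
  proof -
    have "ereal (\<bar>h A - h B\<bar> * \<rho> powr (- \<alpha>)) \<le> ?F \<rho>" using that by (intro SUP_upper)
    also have "\<dots> < ereal (real k)" using \<rho>1 that by blast
    finally have "\<bar>h A - h B\<bar> * \<rho> powr (- \<alpha>) < real k" by simp
    then have "\<bar>h A - h B\<bar> < real k * \<rho> powr \<alpha>"
      using that by (simp add: powr_minus field_simps)
    also have "\<dots> \<le> (real k + 1) * \<rho> powr \<alpha>" by (simp add: distrib_right)
    finally show ?thesis by simp
  qed
  then show thesis using that[of "real k + 1" \<rho>\<^sub>1] \<rho>1 by auto
qed

text \<open>Here \<open>K * 0 powr \<alpha> = 0\<close>, so a jump point close to \<open>A\<close> has positive divergence.\<close>

lemma jump_le_divergence:
  fixes A :: "'a set"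
  assumes ic: "indexing_collection T \<A> \<A>n" and d: "pseudo_metric_on \<A> d"
    and A: "A \<in> \<A>" and h0: "h {} = 0" and gc: "generic_configuration T \<A> \<A>n d h A"
    and \<alpha>: "0 < \<alpha>"
    and fin: "Limsup (at_right 0)
      (\<lambda>\<rho>. SUP B\<in>pm_ball \<A> d A \<rho>. ereal (\<bar>h A - h B\<bar> * \<rho> powr (- \<alpha>))) < \<infinity>"
  obtains K r :: real where "K > 0" "r > 0"
    "\<And>t. t \<in> jump_points T \<A> \<A>n h \<Longrightarrow> divergence \<A> d t A < r \<Longrightarrow>
      \<bar>jump T \<A> \<A>n h t\<bar> \<le> K * divergence \<A> d t A powr \<alpha>"
proof -
  interpret shape_collection \<A> using ic by (rule indexing_collection_shape)
  obtain \<rho>\<^sub>0 where \<rho>0: "\<rho>\<^sub>0 > 0" and gen: "\<And>\<rho> t \<epsilon>. 0 < \<rho> \<Longrightarrow> \<rho> < \<rho>\<^sub>0 \<Longrightarrow>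
      t \<in> jump_points T \<A> \<A>n h \<Longrightarrow> t \<in> victiny \<A> d A \<rho> \<Longrightarrow> \<epsilon> > 0 \<Longrightarrow>
      \<exists>A\<^sub>1\<in>pm_ball \<A> d A \<rho>. \<exists>A\<^sub>2\<in>pm_ball \<A> d A \<rho>. A\<^sub>1 \<subseteq> A\<^sub>2 \<and>
        \<bar>increment \<A> h (A\<^sub>2 - A\<^sub>1) - jump T \<A> \<A>n h t\<bar> \<le> \<epsilon>"
    using gc unfolding generic_configuration_def by (metis IntI)
  obtain K \<rho>\<^sub>1 where K: "K > 0" "\<rho>\<^sub>1 > 0"
    "\<And>\<rho> B. 0 < \<rho> \<Longrightarrow> \<rho> < \<rho>\<^sub>1 \<Longrightarrow> B \<in> pm_ball \<A> d A \<rho> \<Longrightarrow> \<bar>h A - h B\<bar> \<le> K * \<rho> powr \<alpha>"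
    using holder_bound[OF fin] by blast
  define r where "r = min \<rho>\<^sub>0 \<rho>\<^sub>1"
  have "r > 0" using \<rho>0 K by (simp add: r_def)
  \<comment> \<open>The factor \<open>2\<close> arises from comparing both
    \<open>h A\<^sub>1\<close> and \<open>h A\<^sub>2\<close> with \<open>h A\<close>.\<close>
  have "\<bar>jump T \<A> \<A>n h t\<bar> \<le> 2 * K * divergence \<A> d t A powr \<alpha>"
    if t: "t \<in> jump_points T \<A> \<A>n h" and less: "divergence \<A> d t A < r" for t
  proof -
    let ?\<delta> = "divergence \<A> d t A" and ?J = "jump T \<A> \<A>n h t"
    have tT: "t \<in> T" using t by (simp add: jump_points_def)
    have \<delta>: "0 \<le> ?\<delta>" using divergence_nonneg[OF ic d A tT] .
    have bound: "\<bar>?J\<bar> \<le> 2 * K * \<rho> powr \<alpha>" if \<rho>: "?\<delta> < \<rho>" "\<rho> < r" for \<rho>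
    proof (rule field_le_epsilon)
      fix \<epsilon> :: real assume "0 < \<epsilon>"
      have "t \<in> victiny \<A> d A \<rho>" using divergence_less_imp_victiny[OF ic d A tT \<rho>(1)] .
      then obtain A\<^sub>1 A\<^sub>2 where A12: "A\<^sub>1 \<in> pm_ball \<A> d A \<rho>" "A\<^sub>2 \<in> pm_ball \<A> d A \<rho>" "A\<^sub>1 \<subseteq> A\<^sub>2"
        and J: "\<bar>increment \<A> h (A\<^sub>2 - A\<^sub>1) - ?J\<bar> \<le> \<epsilon>"
        using gen[of \<rho> t \<epsilon>] \<rho> \<delta> t \<open>0 < \<epsilon>\<close> by (auto simp: r_def)
      have "\<bar>h A - h A\<^sub>1\<bar> \<le> K * \<rho> powr \<alpha>" "\<bar>h A - h A\<^sub>2\<bar> \<le> K * \<rho> powr \<alpha>"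
        using K(3)[of \<rho>] A12 \<rho> \<delta> by (auto simp: r_def)
      moreover have "increment \<A> h (A\<^sub>2 - A\<^sub>1) = h A\<^sub>2 - h A\<^sub>1"
        using A12 h0 by (intro increment_Diff) (auto simp: pm_ball_def)
      ultimately show "\<bar>?J\<bar> \<le> 2 * K * \<rho> powr \<alpha> + \<epsilon>" using J by linarith
    qed
    \<comment> \<open>The divergence may not be an admissible radius itself, so it is approached
      from the right. If it is zero, right-continuity of the power there relies on
      \<open>0 < \<alpha>\<close>.\<close>
    have "((\<lambda>\<rho>. 2 * K * \<rho> powr \<alpha>) \<longlongrightarrow> 2 * K * ?\<delta> powr \<alpha>) (at_right ?\<delta>)"
      using \<alpha> \<delta> by (intro tendsto_intros) (auto simp: eventually_at_right_field intro: exI[of _ "?\<delta> + 1"])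
    moreover have "eventually (\<lambda>\<rho>. \<bar>?J\<bar> \<le> 2 * K * \<rho> powr \<alpha>) (at_right ?\<delta>)"
      using bound less by (auto simp: eventually_at_right_field)
    ultimately show ?thesis
      by (intro tendsto_lowerbound) auto
  qed
  then show thesis using that[of "2 * K" r] K \<open>r > 0\<close> by auto
qed

section \<open>Passage to logarithms\<close>

text \<open>Dividing the logarithm of the bound by \<open>ln (\<delta> n)\<close>, which is
  eventually negative, reverses the inequality and gives the lower bound
  \<open>\<alpha> + ln K / ln (\<delta> n)\<close>. The constant disappears in the limit since
  \<open>ln (\<delta> n)\<close> tends to minus infinity.\<close>

lemma liminf_log_quotient_ge:
  fixes \<delta> J :: "nat \<Rightarrow> real"
  assumes \<delta>: "\<delta> \<longlonglongrightarrow> 0" "\<And>n. 0 \<le> \<delta> n" and J: "\<And>n. 0 < J n"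
    and K: "K > 0" and le: "eventually (\<lambda>n. J n \<le> K * \<delta> n powr \<alpha>) sequentially"
  shows "ereal \<alpha> \<le> liminf (\<lambda>n. ereal (log_quotient (J n) (\<delta> n)))"
proof -
  have pos: "eventually (\<lambda>n. 0 < \<delta> n) sequentially"
    using le
  proof eventually_elim
    case (elim n)
    \<comment> \<open>In Isabelle \<open>0 powr \<alpha> = 0\<close>, so a zero divergence would
      force \<open>J n \<le> 0\<close>.\<close>
    then have "\<delta> n \<noteq> 0" using J[of n] by (intro notI) simp
    then show ?case using \<delta>(2)[of n] by simp
  qed
  have "filterlim \<delta> (at_right 0) sequentially"
    using \<delta> pos by (auto simp: filterlim_at elim: eventually_mono)
  then have ln_lim: "filterlim (\<lambda>n. ln (\<delta> n)) at_bot sequentially"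
    by (rule filterlim_compose[OF ln_at_0])
  have "(\<lambda>n. \<alpha> + ln K / ln (\<delta> n)) \<longlonglongrightarrow> \<alpha> + 0"
    by (intro tendsto_intros tendsto_divide_0[OF tendsto_const] filterlim_at_bot_imp_at_infinity ln_lim)
  then have "(\<lambda>n. ereal (\<alpha> + ln K / ln (\<delta> n))) \<longlonglongrightarrow> ereal \<alpha>" by simp
  then have "ereal \<alpha> = liminf (\<lambda>n. ereal (\<alpha> + ln K / ln (\<delta> n)))"
    by (intro lim_imp_Liminf[symmetric] trivial_limit_sequentially)
  also have "\<dots> \<le> liminf (\<lambda>n. ereal (log_quotient (J n) (\<delta> n)))"
  proof (rule Liminf_mono)
    have "eventually (\<lambda>n. ln (\<delta> n) < 0) sequentially"
      using ln_lim by (simp add: filterlim_at_bot_dense)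
    with le pos show "eventually (\<lambda>n. ereal (\<alpha> + ln K / ln (\<delta> n))
        \<le> ereal (log_quotient (J n) (\<delta> n))) sequentially"
    proof eventually_elim
      case (elim n)
      have "ln (J n) \<le> ln (K * \<delta> n powr \<alpha>)" using elim J[of n] by simp
      also have "\<dots> = ln K + \<alpha> * ln (\<delta> n)" using elim K by (simp add: ln_mult)
      finally have "(ln K + \<alpha> * ln (\<delta> n)) / ln (\<delta> n) \<le> ln (J n) / ln (\<delta> n)"
        using elim by (intro divide_right_mono_neg) auto
      then have "\<alpha> + ln K / ln (\<delta> n) \<le> ln (J n) / ln (\<delta> n)"
        using elim by (simp add: add_divide_distrib)
      then show ?case using elim by (simp add: log_quotient_def)
    qed
  qed
  finally show ?thesis .
qed

theorem theorem3p8: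
  fixes T :: "'a set" and \<A> :: "'a set set" and \<A>n :: "nat \<Rightarrow> 'a set set"
    and d :: "'a set \<Rightarrow> 'a set \<Rightarrow> real" and m :: "'a measure"
    and h :: "'a set \<Rightarrow> real" and A :: "'a set" and s :: "nat \<Rightarrow> 'a"
  assumes "indexing_collection T \<A> \<A>n"
    and "finite_dimension \<A> \<A>n"
    and "compatible_metric T \<A> \<A>n d"
    and "reference_measure T \<A> \<A>n m"
    and "A \<in> \<A>"
    and "h {} = 0"
    and "only_jump_irregular T \<A> \<A>n m h"
    and "generic_configuration T \<A> \<A>n d h A"
    and "\<And>n. s n \<in> jump_points T \<A> \<A>n h"
    and "(\<lambda>n. divergence \<A> d (s n) A) \<longlonglongrightarrow> 0"
  shows "holder_exponent \<A> d h A
    \<le> max (liminf (\<lambda>n. ereal (log_quotient \<bar>jump T \<A> \<A>n h (s n)\<bar> (divergence \<A> d (s n) A)))) 0"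
proof -
  let ?J = "jump T \<A> \<A>n h" and ?\<delta> = "\<lambda>t. divergence \<A> d t A"
  let ?l = "liminf (\<lambda>n. ereal (log_quotient \<bar>?J (s n)\<bar> (?\<delta> (s n))))"
  have d: "pseudo_metric_on \<A> d" using assms(3) by (simp add: compatible_metric_def)
  have bound: "ereal \<alpha> \<le> ?l" if \<alpha>: "0 < \<alpha>" and fin: "Limsup (at_right 0)
      (\<lambda>\<rho>. SUP B\<in>pm_ball \<A> d A \<rho>. ereal (\<bar>h A - h B\<bar> * \<rho> powr (- \<alpha>))) < \<infinity>" for \<alpha> :: real
  proof -
    obtain K r where K: "K > 0" "r > 0" "\<And>t. t \<in> jump_points T \<A> \<A>n h \<Longrightarrow> ?\<delta> t < r \<Longrightarrow>
        \<bar>?J t\<bar> \<le> K * ?\<delta> t powr \<alpha>"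
      using jump_le_divergence[OF assms(1) d assms(5,6,8) \<alpha> fin] by blast
    have s: "s n \<in> T" "?J (s n) \<noteq> 0" for n using assms(9)[of n] by (auto simp: jump_points_def)
    have "eventually (\<lambda>n. ?\<delta> (s n) < r) sequentially" using assms(10) K(2) by (rule order_tendstoD)
    then have "eventually (\<lambda>n. \<bar>?J (s n)\<bar> \<le> K * ?\<delta> (s n) powr \<alpha>) sequentially"
      by eventually_elim (rule K(3)[OF assms(9)])
    then show ?thesis
      using s assms(10) K(1) divergence_nonneg[OF assms(1) d assms(5)]
      by (intro liminf_log_quotient_ge[of "\<lambda>n. ?\<delta> (s n)" "\<lambda>n. \<bar>?J (s n)\<bar>"]) auto
  qed
  show ?thesis
    unfolding holder_exponent_def
  proof (rule Sup_least, elim insertE CollectE exE conjE)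
    fix x :: ereal and \<alpha> :: real
    assume x: "x = ereal \<alpha>" and "0 \<le> \<alpha>" and fin: "Limsup (at_right 0)
      (\<lambda>\<rho>. SUP B\<in>pm_ball \<A> d A \<rho>. ereal (\<bar>h A - h B\<bar> * \<rho> powr (- \<alpha>))) < \<infinity>"
    show "x \<le> max ?l 0"
    \<comment> \<open>The bound covers positive exponents only; exponent \<open>0\<close> is
      absorbed by the \<open>0\<close> in the maximum, as is the element \<open>0\<close> inserted
      into the supremum.\<close>
    proof (cases "\<alpha> = 0")
      case True
      then show ?thesis unfolding x by (simp add: zero_ereal_def)
    next
      case False
      with \<open>0 \<le> \<alpha>\<close> have "0 < \<alpha>" by simp
      then have "ereal \<alpha> \<le> ?l" using fin by (rule bound)
      then show ?thesis unfolding x by (rule max.coboundedI1)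
    qed
  qed simp
qed

end
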